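(* There is no way to extend the usual representation of $\mathfrak{alt}$ as conformal vector fields into an embedding of $\mathcal{W}$ into the Lie algebra of vector fields on $\mathbb{R}^3$. That is, there is no injective Lie algebra homomorphism $\rho$ from $\mathcal{W}$ to the Lie algebra of (smooth) vector fields on $\mathbb{R}^3$ such that $$\rho(L_1)=V_+,\quad \rho(L_0)=D,\quad \rho(L_{-1})=Y_{-1/2},\quad \rho(L_1^{\varepsilon})=2X_1,\quad \rho(L_0^{\varepsilon})=Y_{1/2},\quad \rho(L_{-1}^{\varepsilon})=M_0,$$ where $V_+,D,Y_{-1/2},X_1,Y_{1/2},M_0$ are the conformal vector fields on $\mathbb{R}^3$ given in the context.
   Context: $\mathcal{W}=\mathrm{Vect}(S^1)\otimes\mathbb{R}[\varepsilon]/\varepsilon^2$ is the real Lie algebra with basis $(L_n)_{n\in\mathbb{Z}},(L_n^{\varepsilon})_{n\in\mathbb{Z}}$ and brackets $$[L_n,L_m]=(n-m)L_{n+m},\quad [L_n,L_m^{\varepsilon}]=(n-m)L_{n+m}^{\varepsilon},\quad [L_n^{\varepsilon},L_m^{\varepsilon}]=0.$$ The Lie algebra $\mathfrak{alt}$ is a maximal parabolic subalgebra of the conformal algebra $\mathfrak{conf}_3$. Its usual representation by conformal vector fields on $\mathbb{R}^3$, with coordinates $(t,r,\zeta)$ and metric given by the quadratic form $r^2-2t\zeta$, is $$V_+=-2tr\,\partial_t-(r^2+2t\zeta)\,\partial_r-2\zeta r\,\partial_\zeta,\quad D=-t\,\partial_t-r\,\partial_r-\zeta\,\partial_\zeta,\quad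 Y_{-1/2}=-\partial_r,$$ $$X_1=-t^2\,\partial_t-tr\,\partial_r-\tfrac12 r^2\,\partial_\zeta,\quad Y_{1/2}=-t\,\partial_r-r\,\partial_\zeta,\quad M_0=-\partial_\zeta .$$ The algebra $\mathfrak{alt}\simeq\mathfrak{sl}(2,\mathbb{R})\otimes\mathbb{R}[\varepsilon]/\varepsilon^2$ is embedded in $\mathcal{W}$ by $$V_+\mapsto L_1,\ D\mapsto L_0,\ Y_{-1/2}\mapsto L_{-1},\ X_1\mapsto\tfrac12L_1^{\varepsilon},\ Y_{1/2}\mapsto L_0^{\varepsilon},\ M_0\mapsto L_{-1}^{\varepsilon}.$$ The bracket of vector fields is the usual commutator. *)

theory Defs
  imports "HOL-Analysis.Analysis" "HOL-Analysis.Finite_Function_Topology"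
begin

section \<open>The real Lie algebra \<open>\<W>\<close>\<close>

text \<open>\<open>\<W>\<close> is the space of finitely supported real functions on the set of basis
  labels; \<open>L n\<close> stands for \<open>L\<^sub>n\<close> and \<open>Le n\<close> for \<open>L\<^sub>n\<^sup>\<epsilon>\<close>.\<close>

datatype W_index = L int | Le int

type_synonym W = "W_index \<Rightarrow>\<^sub>0 real"

abbreviation W_basis :: "W_index \<Rightarrow> W" where
  "W_basis a \<equiv> Poly_Mapping.single a 1"

fun W_basis_bracket :: "W_index \<Rightarrow> W_index \<Rightarrow> W" where
  "W_basis_bracket (L n) (L m) = of_int (n - m) *\<^sub>R W_basis (L (n + m))"
| "W_basis_bracket (L n) (Le m) = of_int (n - m) *\<^sub>R W_basis (Le (n + m))"
| "W_basis_bracket (Le n) (L m) = - (of_int (m - n) *\<^sub>R W_basis (Le (m + n)))"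
| "W_basis_bracket (Le n) (Le m) = 0"

definition W_bracket :: "W \<Rightarrow> W \<Rightarrow> W" where
  "W_bracket x y = (\<Sum>a\<in>Poly_Mapping.keys x. \<Sum>b\<in>Poly_Mapping.keys y.
     (Poly_Mapping.lookup x a * Poly_Mapping.lookup y b) *\<^sub>R W_basis_bracket a b)"

lemma lookup_scaleR_W [simp]:
  "Poly_Mapping.lookup (c *\<^sub>R x) a = c * Poly_Mapping.lookup (x :: W) a"
proof -
  have "finite {i. c *\<^sub>R Poly_Mapping.lookup x i \<noteq> 0}"
    by (rule finite_subset[OF _ finite_lookup[of x]]) auto
  then show ?thesis
    by (simp add: scaleR_poly_mapping_def)
qed

lemma W_expand: "x = (\<Sum>a\<in>Poly_Mapping.keys x. Poly_Mapping.lookup x a *\<^sub>R W_basis a)"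
  for x :: W
proof (rule poly_mapping_eqI)
  fix k
  have "Poly_Mapping.lookup (\<Sum>a\<in>Poly_Mapping.keys x. Poly_Mapping.lookup x a *\<^sub>R W_basis a) k
      = (\<Sum>a\<in>Poly_Mapping.keys x. if a = k then Poly_Mapping.lookup x a else 0)"
    unfolding lookup_sum by (intro sum.cong refl) (simp add: lookup_single when_def)
  also have "\<dots> = Poly_Mapping.lookup x k"
    by (simp add: sum.delta in_keys_iff)
  finally show "Poly_Mapping.lookup x k =
    Poly_Mapping.lookup (\<Sum>a\<in>Poly_Mapping.keys x. Poly_Mapping.lookup x a *\<^sub>R W_basis a) k"
    by simp
qed

lemma inj_W_basis: "inj W_basis"
  by (rule injI) (metis lookup_single_eq lookup_single_not_eq zero_neq_one)

lemma span_W_basis: "span (range W_basis) = UNIV"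
proof -
  have "x \<in> span (range W_basis)" for x :: W
    by (subst W_expand) (intro span_sum span_scale span_base rangeI)
  then show ?thesis by auto
qed

lemma independent_W_basis: "independent (range W_basis)"
proof -
  have "u v = 0"
    if t: "finite t" "t \<subseteq> range W_basis" and eq: "(\<Sum>v\<in>t. u v *\<^sub>R v) = 0" and v: "v \<in> t"
    for t and u :: "W \<Rightarrow> real" and v
  proof -
    obtain a where a: "v = W_basis a" using t v by auto
    have "Poly_Mapping.lookup (\<Sum>w\<in>t. u w *\<^sub>R w) a = (\<Sum>w\<in>t. if w = v then u w else 0)"
      unfolding lookup_sum
    proof (intro sum.cong refl)
      fix w assume "w \<in> t"
      then obtain b where b: "w = W_basis b" using t by auto
      show "Poly_Mapping.lookup (u w *\<^sub>R w) a = (if w = v then u w else 0)"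
        using inj_W_basis by (auto simp: a b lookup_single when_def dest: injD)
    qed
    then show ?thesis using t v eq by simp
  qed
  then show ?thesis
    unfolding independent_explicit_module by blast
qed

lemma W_bracket_superset:
  assumes "finite A" "finite B" "Poly_Mapping.keys x \<subseteq> A" "Poly_Mapping.keys y \<subseteq> B"
  shows "W_bracket x y = (\<Sum>a\<in>A. \<Sum>b\<in>B.
     (Poly_Mapping.lookup x a * Poly_Mapping.lookup y b) *\<^sub>R W_basis_bracket a b)"
proof -
  have "W_bracket x y = (\<Sum>a\<in>Poly_Mapping.keys x. \<Sum>b\<in>B.
     (Poly_Mapping.lookup x a * Poly_Mapping.lookup y b) *\<^sub>R W_basis_bracket a b)"
    unfolding W_bracket_def using assms
    by (intro sum.cong refl sum.mono_neutral_left) (auto simp: in_keys_iff)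
  also have "\<dots> = (\<Sum>a\<in>A. \<Sum>b\<in>B.
     (Poly_Mapping.lookup x a * Poly_Mapping.lookup y b) *\<^sub>R W_basis_bracket a b)"
    using assms by (intro sum.mono_neutral_left) (auto simp: in_keys_iff)
  finally show ?thesis .
qed

lemma W_bracket_basis [simp]: "W_bracket (W_basis a) (W_basis b) = W_basis_bracket a b"
  by (simp add: W_bracket_def)

lemma W_bracket_add_left: "W_bracket (x + y) z = W_bracket x z + W_bracket y z"
proof -
  let ?A = "Poly_Mapping.keys x \<union> Poly_Mapping.keys y" and ?B = "Poly_Mapping.keys z"
  have sub: "Poly_Mapping.keys (x + y) \<subseteq> ?A" by (rule keys_add)
  show ?thesis
    using W_bracket_superset[of ?A ?B "x + y" z] W_bracket_superset[of ?A ?B x z]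
      W_bracket_superset[of ?A ?B y z] sub
    by (simp add: lookup_add algebra_simps sum.distrib)
qed

lemma W_bracket_scaleR_left: "W_bracket (c *\<^sub>R x) y = c *\<^sub>R W_bracket x y"
proof -
  have "Poly_Mapping.keys (c *\<^sub>R x) \<subseteq> Poly_Mapping.keys x"
    by (auto simp: in_keys_iff)
  then show ?thesis
    using W_bracket_superset[of "Poly_Mapping.keys x" "Poly_Mapping.keys y" "c *\<^sub>R x" y]
    by (simp add: W_bracket_def scaleR_right.sum mult.assoc)
qed

lemma W_basis_bracket_antisym: "W_basis_bracket a b = - W_basis_bracket b a"
  by (cases a; cases b) (simp_all add: add.commute flip: scaleR_minus_left)

lemma W_bracket_antisym: "W_bracket x y = - W_bracket y x"
proof -
  have "W_bracket y x = (\<Sum>a\<in>Poly_Mapping.keys x. \<Sum>b\<in>Poly_Mapping.keys y.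
     (Poly_Mapping.lookup y b * Poly_Mapping.lookup x a) *\<^sub>R W_basis_bracket b a)"
    unfolding W_bracket_def by (rule sum.swap)
  also have "\<dots> = (\<Sum>a\<in>Poly_Mapping.keys x. \<Sum>b\<in>Poly_Mapping.keys y.
     - ((Poly_Mapping.lookup x a * Poly_Mapping.lookup y b) *\<^sub>R W_basis_bracket a b))"
    by (intro sum.cong refl) (subst W_basis_bracket_antisym, simp add: mult.commute)
  finally show ?thesis
    by (simp add: W_bracket_def sum_negf)
qed

lemma W_bracket_self: "W_bracket x x = 0"
proof -
  have "W_bracket x x + W_bracket x x = 0"
    using W_bracket_antisym[of x x] by (metis add.right_inverse)
  then have "2 *\<^sub>R W_bracket x x = 0" by (simp add: scaleR_2)
  then show ?thesis by simp
qed

lemma W_bracket_add_right: "W_bracket z (x + y) = W_bracket z x + W_bracket z y"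
  by (metis W_bracket_antisym W_bracket_add_left minus_add_distrib)

lemma W_bracket_scaleR_right: "W_bracket x (c *\<^sub>R y) = c *\<^sub>R W_bracket x y"
  by (metis W_bracket_antisym W_bracket_scaleR_left scaleR_minus_right)

lemma linear_W_bracket_right: "linear (W_bracket x)"
  by (rule linearI) (simp_all add: W_bracket_add_right W_bracket_scaleR_right)

lemma W_induct [case_names zero add scale basis]:
  fixes x :: W
  assumes "P 0" "\<And>x y. P x \<Longrightarrow> P y \<Longrightarrow> P (x + y)" "\<And>c x. P x \<Longrightarrow> P (c *\<^sub>R x)"
    and "\<And>a. P (W_basis a)"
  shows "P x"
proof -
  have "x \<in> span (range W_basis)" by (simp add: span_W_basis)
  then show ?thesis
    by (induction rule: span_induct_alt) (use assms in auto)
qed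

lemma W_jacobi_basis:
  "W_bracket (W_basis a) (W_bracket (W_basis b) (W_basis c))
     + W_bracket (W_basis b) (W_bracket (W_basis c) (W_basis a))
     + W_bracket (W_basis c) (W_bracket (W_basis a) (W_basis b)) = 0"
proof -
  have neg: "W_bracket x (- y) = - W_bracket x y" for x y
    using W_bracket_scaleR_right[of x "-1" y] by simp
  have z: "W_bracket x 0 = 0" for x
    using W_bracket_scaleR_right[of x 0 0] by simp
  show ?thesis
    by (cases a; cases b; cases c)
      (simp_all add: neg z W_bracket_scaleR_right flip: scaleR_left_distrib scaleR_minus_left,
       simp_all add: ac_simps flip: scaleR_left_distrib scaleR_minus_left scaleR_left_diff_distrib,
       simp_all add: algebra_simps)
qed

lemma W_jacobi:
  "W_bracket x (W_bracket y z) + W_bracket y (W_bracket z x) + W_bracket z (W_bracket x y) = 0"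
proof -
  have z: "W_bracket 0 x = 0" "W_bracket x 0 = 0" for x
    using W_bracket_scaleR_left[of 0 0 x] W_bracket_scaleR_right[of x 0 0] by simp_all
  note lin = z W_bracket_add_left W_bracket_add_right W_bracket_scaleR_left
    W_bracket_scaleR_right
  let ?J = "\<lambda>x y z. W_bracket x (W_bracket y z) + W_bracket y (W_bracket z x)
    + W_bracket z (W_bracket x y)"
  have add: "?J (x + x') y z = ?J x y z + ?J x' y z" "?J x (y + y') z = ?J x y z + ?J x y' z"
    "?J x y (z + z') = ?J x y z + ?J x y z'" for x x' y y' z z'
    by (simp_all add: lin)
  have scale: "?J (c *\<^sub>R x) y z = c *\<^sub>R ?J x y z" "?J x (c *\<^sub>R y) z = c *\<^sub>R ?J x y z"
    "?J x y (c *\<^sub>R z) = c *\<^sub>R ?J x y z" for c x y z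
    by (simp_all add: lin scaleR_add_right)
  have 1: "?J x (W_basis b) (W_basis c) = 0" for x b c
  proof (induction x rule: W_induct)
    case (basis a) show ?case by (rule W_jacobi_basis)
  qed (simp add: z, simp only: add add_0, simp only: scale scaleR_zero_right)
  have 2: "?J x y (W_basis c) = 0" for x y c
  proof (induction y rule: W_induct)
    case (basis b) show ?case by (rule 1)
  qed (simp add: z, simp only: add add_0, simp only: scale scaleR_zero_right)
  show ?thesis
  proof (induction z rule: W_induct)
    case (basis c) show ?case by (rule 2)
  qed (simp add: z, simp only: add add_0, simp only: scale scaleR_zero_right)
qed


section \<open>Smooth vector fields on \<open>\<real>\<^sup>3\<close>\<close>

text \<open>A vector field \<open>X\<^sup>t \<partial>\<^sub>t + X\<^sup>r \<partial>\<^sub>r + X\<^sup>\<zeta> \<partial>\<^sub>\<zeta>\<close> is the map \<open>p \<mapsto> (X\<^sup>t p, X\<^sup>r p, X\<^sup>\<zeta> p)\<close>.\<close>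

type_synonym vf = "real ^ 3 \<Rightarrow> real ^ 3"

fun Ck :: "nat \<Rightarrow> ('a::real_normed_vector \<Rightarrow> 'b::real_normed_vector) \<Rightarrow> bool" where
  "Ck 0 f \<longleftrightarrow> continuous_on UNIV f"
| "Ck (Suc k) f \<longleftrightarrow>
     (\<forall>p. f differentiable at p) \<and> (\<forall>v. Ck k (\<lambda>p. frechet_derivative f (at p) v))"

definition smooth :: "('a::real_normed_vector \<Rightarrow> 'b::real_normed_vector) \<Rightarrow> bool" where
  "smooth f \<longleftrightarrow> (\<forall>k. Ck k f)"

text \<open>The derivative \<open>X f = \<Sum>\<^sub>i X\<^sup>i \<partial>\<^sub>i f\<close> of \<open>f\<close> along \<open>X\<close>.\<close>

definition vf_act :: "vf \<Rightarrow> (real ^ 3 \<Rightarrow> real) \<Rightarrow> real ^ 3 \<Rightarrow> real" where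
  "vf_act X f p = frechet_derivative f (at p) (X p)"

text \<open>The commutator \<open>X Y - Y X\<close> of differential operators; a vector field is determined by
  its values on the coordinate functions, and \<open>Y\<close> maps the \<open>i\<close>-th one to \<open>Y\<^sup>i\<close>.\<close>

definition vf_bracket :: "vf \<Rightarrow> vf \<Rightarrow> vf" where
  "vf_bracket X Y p =
     (\<chi> i. vf_act X (\<lambda>q. Y q $ i) p - vf_act Y (\<lambda>q. X q $ i) p)"

lemma vf_bracket_frechet:
  assumes "X differentiable at p" "Y differentiable at p"
  shows "vf_bracket X Y p = frechet_derivative Y (at p) (X p) - frechet_derivative X (at p) (Y p)"
proof -
  have "frechet_derivative (\<lambda>q. Z q $ i) (at p) v = frechet_derivative Z (at p) v $ i"
    if "Z differentiable at p" for Z :: vf and i v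
  proof -
    have "((\<lambda>q. Z q $ i) has_derivative (\<lambda>v. frechet_derivative Z (at p) v $ i)) (at p)"
      using that by (intro bounded_linear.has_derivative[OF bounded_linear_vec_nth])
        (simp add: frechet_derivative_works)
    then show ?thesis by (metis frechet_derivative_at)
  qed
  with assms show ?thesis by (simp add: vf_bracket_def vf_act_def vec_eq_iff)
qed

lemma Ck_Suc_imp: "Ck (Suc k) f \<Longrightarrow> Ck k f"
proof (induction k arbitrary: f)
  case 0
  then show ?case
    by (auto simp: continuous_on_eq_continuous_at intro: differentiable_imp_continuous_within)
next
  case (Suc k)
  have "Ck k (\<lambda>p. frechet_derivative f (at p) v)" for v
    using Suc.prems unfolding Ck.simps(2)[of "Suc k" f] by (intro Suc.IH) blast
  moreover have "f differentiable at p" for p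
    using Suc.prems unfolding Ck.simps(2)[of "Suc k" f] by blast
  ultimately show ?case unfolding Ck.simps(2)[of k f] by blast
qed

lemma Ck_add: "Ck k f \<Longrightarrow> Ck k g \<Longrightarrow> Ck k (\<lambda>p. f p + g p)"
proof (induction k arbitrary: f g)
  case 0
  then show ?case by (auto intro: continuous_intros)
next
  case (Suc k)
  have "frechet_derivative (\<lambda>p. f p + g p) (at p) =
      (\<lambda>v. frechet_derivative f (at p) v + frechet_derivative g (at p) v)" for p
    using Suc.prems by (intro frechet_derivative_at[symmetric] has_derivative_add)
      (auto simp: frechet_derivative_works)
  with Suc show ?case by simp
qed

lemma Ck_bounded_linear:
  assumes "bounded_linear h"
  shows "Ck k f \<Longrightarrow> Ck k (\<lambda>p. h (f p))"
proof (induction k arbitrary: f)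
  case 0
  then show ?case using assms by (auto intro: bounded_linear.continuous_on)
next
  case (Suc k)
  have d: "((\<lambda>p. h (f p)) has_derivative (\<lambda>v. h (frechet_derivative f (at p) v))) (at p)" for p
    using Suc.prems by (intro bounded_linear.has_derivative[OF assms])
      (auto simp: frechet_derivative_works)
  then have "frechet_derivative (\<lambda>p. h (f p)) (at p) =
      (\<lambda>v. h (frechet_derivative f (at p) v))" for p
    by (intro frechet_derivative_at[symmetric])
  with Suc d show ?case by (auto simp: differentiable_def)
qed

lemma Ck_scaleR: "Ck k f \<Longrightarrow> Ck k g \<Longrightarrow> Ck k (\<lambda>p. f p *\<^sub>R g p)"
proof (induction k arbitrary: f g)
  case 0
  then show ?case by (auto intro: continuous_intros)
next
  case (Suc k)
  have d: "((\<lambda>p. f p *\<^sub>R g p) has_derivative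
      (\<lambda>v. f p *\<^sub>R frechet_derivative g (at p) v + frechet_derivative f (at p) v *\<^sub>R g p)) (at p)" for p
    using Suc.prems by (intro has_derivative_scaleR) (auto simp: frechet_derivative_works)
  then have eq: "frechet_derivative (\<lambda>p. f p *\<^sub>R g p) (at p) =
      (\<lambda>v. f p *\<^sub>R frechet_derivative g (at p) v + frechet_derivative f (at p) v *\<^sub>R g p)" for p
    by (intro frechet_derivative_at[symmetric])
  have "Ck k f" "Ck k g" by (rule Suc.prems[THEN Ck_Suc_imp])+
  with Suc.IH Suc.prems have
    "Ck k (\<lambda>p. f p *\<^sub>R frechet_derivative g (at p) v + frechet_derivative f (at p) v *\<^sub>R g p)" for v
    by (intro Ck_add) auto
  with d show ?case by (auto simp: differentiable_def eq)
qed

lemma Ck_const: "Ck k (\<lambda>p. c)"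
  by (induction k arbitrary: c) (auto simp: frechet_derivative_const)

lemma Ck_sum: "(\<And>i. i \<in> I \<Longrightarrow> Ck k (f i)) \<Longrightarrow> Ck k (\<lambda>p. \<Sum>i\<in>I. f i p)"
  by (induction I rule: infinite_finite_induct) (auto intro: Ck_add simp: Ck_const)

lemma smooth_vf_bracket:
  assumes "smooth X" "smooth Y"
  shows "smooth (vf_bracket X Y)"
proof -
  have d: "Z differentiable at p" if "smooth Z" for Z :: vf and p
    using that[unfolded smooth_def, rule_format, of "Suc 0"] by simp
  have *: "Ck k (\<lambda>p. frechet_derivative Y (at p) (X p))" if "smooth X" "smooth Y" for X Y :: vf and k
  proof -
    have "frechet_derivative Y (at p) (X p) =
        (\<Sum>i\<in>Basis. (X p \<bullet> i) *\<^sub>R frechet_derivative Y (at p) i)" for p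
    proof -
      have lin: "linear (frechet_derivative Y (at p))"
        using d[OF that(2)] by (rule linear_frechet_derivative)
      have "frechet_derivative Y (at p) (X p) =
          frechet_derivative Y (at p) (\<Sum>i\<in>Basis. (X p \<bullet> i) *\<^sub>R i)"
        by (simp only: euclidean_representation)
      then show ?thesis
        by (simp only: linear_sum[OF lin] linear_scale[OF lin])
    qed
    moreover have "Ck k (\<lambda>p. (X p \<bullet> i) *\<^sub>R frechet_derivative Y (at p) i)" for i
    proof (rule Ck_scaleR)
      have "Ck k X" using that(1) by (simp add: smooth_def)
      then show "Ck k (\<lambda>p. X p \<bullet> i)"
        by (rule Ck_bounded_linear[OF bounded_linear_inner_left])
      show "Ck k (\<lambda>p. frechet_derivative Y (at p) i)"
        using that(2)[unfolded smooth_def, rule_format, of "Suc k"] by simp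
    qed
    then have "Ck k (\<lambda>p. \<Sum>i\<in>Basis. (X p \<bullet> i) *\<^sub>R frechet_derivative Y (at p) i)"
      by (rule Ck_sum)
    ultimately show ?thesis by simp
  qed
  have "vf_bracket X Y = (\<lambda>p. frechet_derivative Y (at p) (X p) +
      (- 1) *\<^sub>R frechet_derivative X (at p) (Y p))"
    using assms d by (simp add: fun_eq_iff vf_bracket_frechet)
  then show ?thesis
    by (simp only: smooth_def Ck_add[OF *[OF assms] Ck_scaleR[OF Ck_const *[OF assms(2,1)]]])
      simp
qed

text \<open>Lie algebra homomorphisms from \<open>\<W>\<close> to the Lie algebra of smooth vector fields on
  \<open>\<real>\<^sup>3\<close>.\<close>

definition W_lie_hom :: "(W \<Rightarrow> vf) \<Rightarrow> bool" where
  "W_lie_hom \<rho> \<longleftrightarrow>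
     (\<forall>x. smooth (\<rho> x)) \<and>
     (\<forall>x y. \<rho> (x + y) = (\<lambda>p. \<rho> x p + \<rho> y p)) \<and>
     (\<forall>c x. \<rho> (c *\<^sub>R x) = (\<lambda>p. c *\<^sub>R \<rho> x p)) \<and>
     (\<forall>x y. \<rho> (W_bracket x y) = vf_bracket (\<rho> x) (\<rho> y))"

text \<open>The conformal vector fields; \<open>t\<close>, \<open>r\<close>, \<open>\<zeta>\<close> are the components 1, 2, 3.
  \<open>Y_minus\<close> is \<open>Y\<close> with index \<open>-1/2\<close> and \<open>Y_plus\<close> is \<open>Y\<close> with index \<open>1/2\<close>.\<close>

definition V_plus :: vf where
  "V_plus p = (let t = p $ 1; r = p $ 2; z = p $ 3 in
     vector [- 2 * t * r, - (r\<^sup>2 + 2 * t * z), - 2 * z * r])"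

definition D :: vf where
  "D p = (let t = p $ 1; r = p $ 2; z = p $ 3 in vector [- t, - r, - z])"

definition Y_minus :: vf where
  "Y_minus p = vector [0, - 1, 0]"

definition X_1 :: vf where
  "X_1 p = (let t = p $ 1; r = p $ 2; z = p $ 3 in
     vector [- t\<^sup>2, - t * r, - (1 / 2) * r\<^sup>2])"

definition Y_plus :: vf where
  "Y_plus p = (let t = p $ 1; r = p $ 2; z = p $ 3 in vector [0, - t, - r])"

definition M_0 :: vf where
  "M_0 p = vector [0, 0, - 1]"

end

(* Write G for the image of L_2^eps. Since Y_plus and Y_minus agree at p = (1,0,0) and both have
   vanishing t-component, [Y_plus, G] and [Y_minus, G] have the same t-component at p. The first
   bracket is the image of [L_0^eps, L_2^eps] = 0, the second that of
   [L_{-1}, L_2^eps] = -3 L_1^eps, whose t-component at p is 6. *)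

theory Submission
  imports Defs
begin

text \<open>Component \<open>i\<close> of the bracket is \<open>X(Z^i) - Z(X^i)\<close>: the first
  term sees \<open>X\<close> only through \<open>X p\<close>, the second differentiates the zero
  function.\<close>

lemma vf_bracket_component_cong:
  assumes "X p = Y p" "\<And>q. X q $ i = 0" "\<And>q. Y q $ i = 0"
  shows "vf_bracket X Z p $ i = vf_bracket Y Z p $ i"
  using assms by (simp add: vf_bracket_def vf_act_def)

theorem proposition2p4:
  shows "\<not> (\<exists>\<rho> :: W \<Rightarrow> vf.
     W_lie_hom \<rho> \<and> inj \<rho> \<and>
     \<rho> (W_basis (L 1)) = V_plus \<and>
     \<rho> (W_basis (L 0)) = D \<and>
     \<rho> (W_basis (L (- 1))) = Y_minus \<and>
     \<rho> (W_basis (Le 1)) = (\<lambda>p. 2 *\<^sub>R X_1 p) \<and>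
     \<rho> (W_basis (Le 0)) = Y_plus \<and>
     \<rho> (W_basis (Le (- 1))) = M_0)"
proof
  assume "\<exists>\<rho> :: W \<Rightarrow> vf.
     W_lie_hom \<rho> \<and> inj \<rho> \<and>
     \<rho> (W_basis (L 1)) = V_plus \<and>
     \<rho> (W_basis (L 0)) = D \<and>
     \<rho> (W_basis (L (- 1))) = Y_minus \<and>
     \<rho> (W_basis (Le 1)) = (\<lambda>p. 2 *\<^sub>R X_1 p) \<and>
     \<rho> (W_basis (Le 0)) = Y_plus \<and>
     \<rho> (W_basis (Le (- 1))) = M_0"
  then obtain \<rho> :: "W \<Rightarrow> vf" where hom: "W_lie_hom \<rho>"
    and Ym: "\<rho> (W_basis (L (- 1))) = Y_minus"
    and X1: "\<rho> (W_basis (Le 1)) = (\<lambda>p. 2 *\<^sub>R X_1 p)"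
    and Yp: "\<rho> (W_basis (Le 0)) = Y_plus"
    by blast
  have scale: "\<rho> (c *\<^sub>R x) = (\<lambda>p. c *\<^sub>R \<rho> x p)"
    and bracket: "vf_bracket (\<rho> x) (\<rho> y) = \<rho> (W_bracket x y)" for c x y
    using hom by (simp_all add: W_lie_hom_def)
  define G where "G = \<rho> (W_basis (Le 2))"
  define p :: "real ^ 3" where "p = vector [1, 0, 0]"
  \<comment> \<open>Zero is written as a scalar multiple so that \<open>scale\<close> makes its
    image the zero field.\<close>
  have "vf_bracket Y_plus G = \<rho> (0 *\<^sub>R 0)"
    unfolding G_def Yp[symmetric] bracket by simp
  then have "vf_bracket Y_plus G p $ 1 = 0"
    unfolding scale by simp
  moreover have "vf_bracket Y_minus G = \<rho> ((- 3) *\<^sub>R W_basis (Le 1))"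
    unfolding G_def Ym[symmetric] bracket by simp
  \<comment> \<open>The factors are -3 from the bracket, 2 from \<open>X1\<close>, and
    \<open>-t^2 = -1\<close> at \<open>p\<close>.\<close>
  then have "vf_bracket Y_minus G p $ 1 = 6"
    unfolding scale X1 by (simp add: X_1_def p_def)
  moreover have "vf_bracket Y_plus G p $ 1 = vf_bracket Y_minus G p $ 1"
    by (rule vf_bracket_component_cong) (simp_all add: Y_plus_def Y_minus_def p_def)
  ultimately show False by simp
qed

end
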